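(* The moving-horizon method described in the context generates non-negative profiles $\bar P_{jkl},\bar Q_k,\bar U_k,\bar B_k,\bar S_k,\bar S_k^{\rm out}\in\mathbb{R}_+^\delta$ and binary profiles $\bar X_{jk},\bar W_{jk}\in\{0,1\}^\delta$. Moreover, the profile pairs $\{\bar X_{jk},\bar P_{jkl}\}$, $\{\bar S_k^{\rm out},\bar S_k\}$ and $\{\bar B_k,\bar B_k^{\rm IO}\}$ satisfy, respectively, $$R_j^{\rm min}\bar X_{jk}\le\bar P_{jkl}\le R_j^{\rm max}\bar X_{jk},\qquad \bar S_k^{\rm out}\le\bar S_k,\qquad \bar B_k(h+1)=(1-L^P)\bar B_k(h)+\bar B_k^{\rm IO}(h)\ \text{ for } h=1,\dots,\delta-1,$$ where the first two are componentwise.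
   Context: Cogeneration MILP on a time window $\mathcal T$ (a finite set of consecutive integer hours, with first element $t_0$ and last element $t_1$). Technologies: $\mathcal J=\{\text{batt, boil, chp, pow, stor}\}$, with $\mathcal J_g=\{\text{pow, chp}\}$; technology $j$ has identical units indexed by $i\in\mathcal U_j=\{1,\dots,|\mathcal U_j|\}$. $\mathcal M$ is the set of months, $\mathcal T_m\subset\mathcal T$ the hours of month $m$, $t_m$ the end of month $m$. Given real parameters: $C_j$ (capital cost), $H$ (lifetime hours), $T$ (number of hours in the horizon), $Y$ (hourly discount factor), $M_j$ (operation cost), $W_j$ (switching cost), $P_t,G_t$ (electricity and gas prices), $P_m^{\rm max}$ (peak price), $S^c_j$ (thermal capacities), $B^c$ (battery capacity), $D_t^P,D_t^Q$ (demands), $R_j^{\rm min},R_j^{\rm max}$ (min/max output), $E_j^P,E_j^Q$ (efficiencies), $L^P,L^Q$ (loss rates). Variables: $y_j$; $x_{ijt},w_{ijt},p_{ijt}$ and $p_{jt}$ for $j\in\mathcal J_g$, $i\in\mathcal U_j$; $u_t$; $u_m^{\rm max}\ge0$; $b_t$; $b_t^{\rm IO}\in\mathbb{R}$ (free sign); $s_t$; $s_t^{\rm out}$; $q_t$. Minimize $$\sum_{j\in\mathcal J}C_jy_j+\frac HT\Big\{\sum_{m}Y^{t_m}P_m^{\rm max}u_m^{\rm max}+\sum_{t\in\mathcal T}Y^t\Big[\sum_{j\in\mathcal J_g}\Big(M_jp_{jt}+\sum_{i\in\mathcal U_j}W_jw_{ijt}\Big)+G_tq_t+P_tu_t\Big]\Big\}$$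 subject to (for all applicable indices, $t\in\mathcal T$; constraints involving $t+1$ hold for $t\in\mathcal T$, $t<t_1$): $y_j\in\mathbb{Z}$, $0\le y_j\le|\mathcal U_j|$; $\sum_{j\in\mathcal J_g}p_{jt}+u_t-b_t^{\rm IO}\ge D_t^P$; $R_j^{\rm min}x_{ijt}\le p_{ijt}\le R_j^{\rm max}x_{ijt}$ and $p_{jt}=\sum_{i\in\mathcal U_j}p_{ijt}$ ($j\in\mathcal J_g$); $x_{ijt}\in\{0,1\}$, $\sum_{i\in\mathcal U_j}x_{ijt}\le y_j$ ($j\in\mathcal J_g$); $x_{(i+1)jt}\le x_{ijt}$ ($j\in\mathcal J_g$, $i<|\mathcal U_j|$); $x_{ij(t+1)}-x_{ijt}\le w_{ijt}$, $x_{ijt}-x_{ij(t+1)}\le w_{ijt}$, $0\le w_{ijt}\le1$; $0\le u_t\le u_m^{\rm max}$ for $t\in\mathcal T_m$; $b_{t+1}=(1-L^P)b_t+b_t^{\rm IO}$; $b_{t_0}=b_{t_1}$; $0\le b_t\le B^cy_{\rm batt}$; $s_t^{\rm out}+q_t\ge D_t^Q$; $s_{t+1}-(1-L^Q)s_t+s_t^{\rm out}\le(E^Q_{\rm chp}/E^P_{\rm chp})\,p_{{\rm chp},t}$; $s_{t_0}=s_{t_1}$; $s_t^{\rm out}\le s_t\le S^c_{\rm stor}y_{\rm stor}$; $q_t\le S^c_{\rm boil}y_{\rm boil}$; $b_t,p_{ijt},p_{jt},q_t,s_t,s_t^{\rm out},u_t\ge0$. Moving-horizon method. Let the profile length be $\delta$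 (hours per day), the full horizon $D$ days, and the window length $w$ days, $w\ll D$. Set $r=0$, $\mathcal W=\{1,\dots,\delta w\}$, $\mathcal R=\{1,\dots,\delta\}$. While $r+w\le D$: (1) compute an optimal solution of the MILP on the window $\mathcal T=\mathcal W$ (assumed to exist); (2) restrict the solution $\{x_{ijt},p_{ijt},q_t,u_t,b_t,b_t^{\rm IO},s_t,s_t^{\rm out}\}$ to $t\in\mathcal R$; (3) extract profiles as described below; (4) set $r\leftarrow r+1$; if $r+w<D$ set $\mathcal W=\{\delta r+1,\dots,\delta(r+w)\}$, $\mathcal R=\{\delta r+1,\dots,\delta(r+1)\}$; if $r+w=D$ set $\mathcal W=\mathcal R=\{\delta r+1,\dots,\delta D\}$. Extraction of profiles. $\mathcal R$ is a union of days, a day being a set $\{\delta e+1,\dots,\delta e+\delta\}$. For each such day, a profile is the vector in $\mathbb{R}^\delta$ whose $h$-th entry, written e.g. $\bar B_k(h)$, is the value of the variable at hour $t=\delta e+h$: $\bar Q_k,\bar U_k$ come from $q_t,u_t$; the pairs $(\bar B_k,\bar B_k^{\rm IO})$ and $(\bar S_k,\bar S_k^{\rm out})$ come from $(b_t,b_t^{\rm IO})$ and $(s_t,s_t^{\rm out})$ on the same day of the same solution; for $j\in\mathcal J_g$ the on/off profile $\bar X_{jk}$ comes from $x_{ijt}$ for a unit $i$ on that day, and a production profile $\bar P_{jkl}$ associated with $\bar X_{jk}$ comes from $p_{ijt}$ for a unit and day whose on/off profile is $\bar X_{jk}$ (index $l$ enumerates those associated with the same $\bar X_{jk}$). The switching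 profile is $\bar W_{jk}(h)=|\bar X_{jk}(h+1)-\bar X_{jk}(h)|$, $h=1,\dots,\delta$, where $\bar X_{jk}(\delta+1)\in\{0,1\}$ denotes the on/off value assigned to the hour following the profile (any binary value by convention). *)

theory Defs
  imports Complex_Main "HOL-Library.FuncSet"
begin

datatype tech = Batt | Boil | Chp | Pow | Stor

definition techs :: "tech set" where
  "techs = {Batt, Boil, Chp, Pow, Stor}"

definition gen_techs :: "tech set" where
  "gen_techs = {Pow, Chp}"

text \<open>
  Hours are integers. The months are given by the map \<open>month_of\<close>, so that for a window
  \<open>\<T>\<close> the set \<open>\<T>\<^sub>m\<close> is the fibre of \<open>month_of\<close> over \<open>m\<close> within \<open>\<T>\<close>, and only months
  meeting \<open>\<T>\<close> occur. No sign or non-degeneracy conditions are imposed on the parameters.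
\<close>

record cogen =
  n_units :: "tech \<Rightarrow> nat"
  cap_cost :: "tech \<Rightarrow> real"            (* C_j *)
  lifetime :: real                        (* H *)
  horizon_hours :: real                   (* T *)
  discount :: real                        (* Y *)
  op_cost :: "tech \<Rightarrow> real"             (* M_j *)
  switch_cost :: "tech \<Rightarrow> real"         (* W_j *)
  elec_price :: "int \<Rightarrow> real"           (* P_t *)
  gas_price :: "int \<Rightarrow> real"            (* G_t *)
  peak_price :: "nat \<Rightarrow> real"           (* P_m^max *)
  month_of :: "int \<Rightarrow> nat"
  month_end :: "nat \<Rightarrow> int"             (* t_m *)
  heat_cap :: "tech \<Rightarrow> real"            (* S^c_j *)
  batt_cap :: real                        (* B^c *)
  dem_P :: "int \<Rightarrow> real"
  dem_Q :: "int \<Rightarrow> real"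
  R_min :: "tech \<Rightarrow> real"
  R_max :: "tech \<Rightarrow> real"
  eff_P :: "tech \<Rightarrow> real"               (* E^P_j *)
  eff_Q :: "tech \<Rightarrow> real"               (* E^Q_j *)
  loss_P :: real                          (* L^P *)
  loss_Q :: real                          (* L^Q *)

text \<open>
  All decision variables are real-valued; integrality is a constraint. Argument order follows
  the subscripts, e.g. \<open>v_x S i j t\<close> is \<open>x\<close> for unit \<open>i\<close> of technology \<open>j\<close> at hour \<open>t\<close>;
  \<open>v_pt\<close> is the total output of a technology.
\<close>

record milp_sol =
  v_y :: "tech \<Rightarrow> real"
  v_x :: "nat \<Rightarrow> tech \<Rightarrow> int \<Rightarrow> real"
  v_w :: "nat \<Rightarrow> tech \<Rightarrow> int \<Rightarrow> real"
  v_p :: "nat \<Rightarrow> tech \<Rightarrow> int \<Rightarrow> real"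
  v_pt :: "tech \<Rightarrow> int \<Rightarrow> real"
  v_u :: "int \<Rightarrow> real"
  v_umax :: "nat \<Rightarrow> real"
  v_b :: "int \<Rightarrow> real"
  v_bIO :: "int \<Rightarrow> real"
  v_s :: "int \<Rightarrow> real"
  v_sout :: "int \<Rightarrow> real"
  v_q :: "int \<Rightarrow> real"

definition unit_set :: "cogen \<Rightarrow> tech \<Rightarrow> nat set" where
  "unit_set G j = {1..n_units G j}"

definition months :: "cogen \<Rightarrow> int set \<Rightarrow> nat set" where
  "months G \<T> = month_of G ` \<T>"

definition month_hours :: "cogen \<Rightarrow> int set \<Rightarrow> nat \<Rightarrow> int set" where
  "month_hours G \<T> m = {t \<in> \<T>. month_of G t = m}"

definition cost :: "cogen \<Rightarrow> int set \<Rightarrow> milp_sol \<Rightarrow> real" where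
  "cost G \<T> S =
     (\<Sum>j\<in>techs. cap_cost G j * v_y S j)
     + lifetime G / horizon_hours G *
       ((\<Sum>m\<in>months G \<T>. discount G powi (month_end G m) * peak_price G m * v_umax S m)
        + (\<Sum>t\<in>\<T>. discount G powi t *
             ((\<Sum>j\<in>gen_techs. op_cost G j * v_pt S j t
                  + (\<Sum>i\<in>unit_set G j. switch_cost G j * v_w S i j t))
              + gas_price G t * v_q S t + elec_price G t * v_u S t)))"

definition design_constr :: "cogen \<Rightarrow> milp_sol \<Rightarrow> bool" where
  "design_constr G S \<longleftrightarrow>
     (\<forall>j\<in>techs. v_y S j \<in> \<int> \<and> 0 \<le> v_y S j \<and> v_y S j \<le> real (n_units G j))"

definition gen_constr :: "cogen \<Rightarrow> int set \<Rightarrow> milp_sol \<Rightarrow> bool" where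
  "gen_constr G \<T> S \<longleftrightarrow>
     (\<forall>j\<in>gen_techs. \<forall>t\<in>\<T>.
        v_pt S j t = (\<Sum>i\<in>unit_set G j. v_p S i j t) \<and> 0 \<le> v_pt S j t
        \<and> (\<Sum>i\<in>unit_set G j. v_x S i j t) \<le> v_y S j
        \<and> (\<forall>i\<in>unit_set G j.
              v_x S i j t \<in> {0, 1} \<and> 0 \<le> v_p S i j t
              \<and> R_min G j * v_x S i j t \<le> v_p S i j t
              \<and> v_p S i j t \<le> R_max G j * v_x S i j t
              \<and> 0 \<le> v_w S i j t \<and> v_w S i j t \<le> 1
              \<and> (i < n_units G j \<longrightarrow> v_x S (i + 1) j t \<le> v_x S i j t)
              \<and> (t < Max \<T> \<longrightarrow>
                   v_x S i j (t + 1) - v_x S i j t \<le> v_w S i j t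
                   \<and> v_x S i j t - v_x S i j (t + 1) \<le> v_w S i j t)))"

definition power_constr :: "cogen \<Rightarrow> int set \<Rightarrow> milp_sol \<Rightarrow> bool" where
  "power_constr G \<T> S \<longleftrightarrow>
     (\<forall>t\<in>\<T>. (\<Sum>j\<in>gen_techs. v_pt S j t) + v_u S t - v_bIO S t \<ge> dem_P G t)
     \<and> (\<forall>m\<in>months G \<T>. 0 \<le> v_umax S m
          \<and> (\<forall>t\<in>month_hours G \<T> m. 0 \<le> v_u S t \<and> v_u S t \<le> v_umax S m))"

definition battery_constr :: "cogen \<Rightarrow> int set \<Rightarrow> milp_sol \<Rightarrow> bool" where
  "battery_constr G \<T> S \<longleftrightarrow>
     (\<forall>t\<in>\<T>. t < Max \<T> \<longrightarrow> v_b S (t + 1) = (1 - loss_P G) * v_b S t + v_bIO S t)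
     \<and> v_b S (Min \<T>) = v_b S (Max \<T>)
     \<and> (\<forall>t\<in>\<T>. 0 \<le> v_b S t \<and> v_b S t \<le> batt_cap G * v_y S Batt)"

definition heat_constr :: "cogen \<Rightarrow> int set \<Rightarrow> milp_sol \<Rightarrow> bool" where
  "heat_constr G \<T> S \<longleftrightarrow>
     (\<forall>t\<in>\<T>. v_sout S t + v_q S t \<ge> dem_Q G t)
     \<and> (\<forall>t\<in>\<T>. t < Max \<T> \<longrightarrow>
          v_s S (t + 1) - (1 - loss_Q G) * v_s S t + v_sout S t
            \<le> eff_Q G Chp / eff_P G Chp * v_pt S Chp t)
     \<and> v_s S (Min \<T>) = v_s S (Max \<T>)
     \<and> (\<forall>t\<in>\<T>. 0 \<le> v_sout S t \<and> 0 \<le> v_s S t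
          \<and> v_sout S t \<le> v_s S t \<and> v_s S t \<le> heat_cap G Stor * v_y S Stor
          \<and> 0 \<le> v_q S t \<and> v_q S t \<le> heat_cap G Boil * v_y S Boil)"

definition feasible :: "cogen \<Rightarrow> int set \<Rightarrow> milp_sol \<Rightarrow> bool" where
  "feasible G \<T> S \<longleftrightarrow>
     design_constr G S \<and> gen_constr G \<T> S \<and> power_constr G \<T> S
     \<and> battery_constr G \<T> S \<and> heat_constr G \<T> S"

definition optimal :: "cogen \<Rightarrow> int set \<Rightarrow> milp_sol \<Rightarrow> bool" where
  "optimal G \<T> S \<longleftrightarrow>
     feasible G \<T> S \<and> (\<forall>S'. feasible G \<T> S' \<longrightarrow> cost G \<T> S \<le> cost G \<T> S')"

text \<open>
  The pair of the window \<open>\<W>\<close> and the retained part \<open>\<R>\<close> held by the loop when its counter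
  is \<open>r\<close>. The arguments are the hours per day \<open>\<delta>\<close>, the number of days \<open>D\<close> and the window
  length \<open>w\<close> in days. The loop body is executed exactly for the \<open>r\<close> with \<open>r + w \<le> D\<close>.
\<close>

primrec mh_state :: "nat \<Rightarrow> nat \<Rightarrow> nat \<Rightarrow> nat \<Rightarrow> int set \<times> int set" where
  "mh_state \<delta> D w 0 = ({1..int (\<delta> * w)}, {1..int \<delta>})"
| "mh_state \<delta> D w (Suc r) =
     (if Suc r + w < D then
        ({int (\<delta> * Suc r + 1)..int (\<delta> * (Suc r + w))},
         {int (\<delta> * Suc r + 1)..int (\<delta> * (Suc r + 1))})
      else if Suc r + w = D then
        ({int (\<delta> * Suc r + 1)..int (\<delta> * D)}, {int (\<delta> * Suc r + 1)..int (\<delta> * D)})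
      else mh_state \<delta> D w r)"

definition mh_window :: "nat \<Rightarrow> nat \<Rightarrow> nat \<Rightarrow> nat \<Rightarrow> int set" where
  "mh_window \<delta> D w r = fst (mh_state \<delta> D w r)"

definition mh_retained :: "nat \<Rightarrow> nat \<Rightarrow> nat \<Rightarrow> nat \<Rightarrow> int set" where
  "mh_retained \<delta> D w r = snd (mh_state \<delta> D w r)"

text \<open>
  A run of the method: \<open>sol r\<close> is the optimal solution computed in iteration \<open>r\<close>; which
  optimal solution is returned is left open.
\<close>

definition mh_run :: "cogen \<Rightarrow> nat \<Rightarrow> nat \<Rightarrow> nat \<Rightarrow> (nat \<Rightarrow> milp_sol) \<Rightarrow> bool" where
  "mh_run G \<delta> D w sol \<longleftrightarrow> (\<forall>r. r + w \<le> D \<longrightarrow> optimal G (mh_window \<delta> D w r) (sol r))"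

definition day :: "nat \<Rightarrow> nat \<Rightarrow> int set" where
  "day \<delta> e = {int (\<delta> * e + 1)..int (\<delta> * e + \<delta>)}"

definition extracted :: "nat \<Rightarrow> nat \<Rightarrow> nat \<Rightarrow> (nat \<times> nat) set" where
  "extracted \<delta> D w = {(r, e). r + w \<le> D \<and> day \<delta> e \<subseteq> mh_retained \<delta> D w r}"

text \<open>
  A vector with \<open>\<delta>\<close> entries is a function on \<open>{1..\<delta>}\<close>, extended by \<open>undefined\<close>.
\<close>

definition profile :: "nat \<Rightarrow> (int \<Rightarrow> real) \<Rightarrow> nat \<Rightarrow> (nat \<Rightarrow> real)" where
  "profile \<delta> f e = (\<lambda>h\<in>{1..\<delta>}. f (int (\<delta> * e + h)))"

definition nonneg_vecs :: "nat \<Rightarrow> (nat \<Rightarrow> real) set" where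
  "nonneg_vecs \<delta> = {1..\<delta>} \<rightarrow>\<^sub>E {0..}"

definition binary_vecs :: "nat \<Rightarrow> (nat \<Rightarrow> real) set" where
  "binary_vecs \<delta> = {1..\<delta>} \<rightarrow>\<^sub>E {0, 1}"

text \<open>
  The families of extracted profiles are given by their ranges; the enumeration indices \<open>k\<close>
  and \<open>l\<close> become membership in these sets.
\<close>

definition Q_profiles :: "nat \<Rightarrow> nat \<Rightarrow> nat \<Rightarrow> (nat \<Rightarrow> milp_sol) \<Rightarrow> (nat \<Rightarrow> real) set" where
  "Q_profiles \<delta> D w sol = {profile \<delta> (v_q (sol r)) e | r e. (r, e) \<in> extracted \<delta> D w}"

definition U_profiles :: "nat \<Rightarrow> nat \<Rightarrow> nat \<Rightarrow> (nat \<Rightarrow> milp_sol) \<Rightarrow> (nat \<Rightarrow> real) set" where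
  "U_profiles \<delta> D w sol = {profile \<delta> (v_u (sol r)) e | r e. (r, e) \<in> extracted \<delta> D w}"

definition B_profiles ::
  "nat \<Rightarrow> nat \<Rightarrow> nat \<Rightarrow> (nat \<Rightarrow> milp_sol) \<Rightarrow> ((nat \<Rightarrow> real) \<times> (nat \<Rightarrow> real)) set" where
  "B_profiles \<delta> D w sol =
     {(profile \<delta> (v_b (sol r)) e, profile \<delta> (v_bIO (sol r)) e) | r e.
        (r, e) \<in> extracted \<delta> D w}"

definition S_profiles ::
  "nat \<Rightarrow> nat \<Rightarrow> nat \<Rightarrow> (nat \<Rightarrow> milp_sol) \<Rightarrow> ((nat \<Rightarrow> real) \<times> (nat \<Rightarrow> real)) set" where
  "S_profiles \<delta> D w sol =
     {(profile \<delta> (v_s (sol r)) e, profile \<delta> (v_sout (sol r)) e) | r e.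
        (r, e) \<in> extracted \<delta> D w}"

definition X_profiles ::
  "cogen \<Rightarrow> nat \<Rightarrow> nat \<Rightarrow> nat \<Rightarrow> (nat \<Rightarrow> milp_sol) \<Rightarrow> tech \<Rightarrow> (nat \<Rightarrow> real) set" where
  "X_profiles G \<delta> D w sol j =
     {profile \<delta> (v_x (sol r) i j) e | r e i. (r, e) \<in> extracted \<delta> D w \<and> i \<in> unit_set G j}"

definition P_profiles ::
  "cogen \<Rightarrow> nat \<Rightarrow> nat \<Rightarrow> nat \<Rightarrow> (nat \<Rightarrow> milp_sol) \<Rightarrow> tech \<Rightarrow> (nat \<Rightarrow> real) \<Rightarrow> (nat \<Rightarrow> real) set"
  where
  "P_profiles G \<delta> D w sol j X =
     {profile \<delta> (v_p (sol r) i j) e | r e i.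
        (r, e) \<in> extracted \<delta> D w \<and> i \<in> unit_set G j \<and> profile \<delta> (v_x (sol r) i j) e = X}"

text \<open>
  The switching profile of \<open>X\<close> when the hour following the profile has on/off value \<open>v\<close>.
\<close>

definition switching :: "nat \<Rightarrow> (nat \<Rightarrow> real) \<Rightarrow> real \<Rightarrow> (nat \<Rightarrow> real)" where
  "switching \<delta> X v = (\<lambda>h\<in>{1..\<delta>}. \<bar>(X(\<delta> + 1 := v)) (h + 1) - X h\<bar>)"

end

theory Submission
  imports Defs
begin

text \<open>
  Every property claimed of a profile is a constraint of the window problem read hour by hour.
  It therefore suffices that each hour of an extracted day lies in the window whose solution
  supplies the profile (lemma \<open>extracted_hour_in_window\<close>). This holds because the retained
  hours form an initial segment of the window, or all of it in the last iteration, so that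
  profiles inherit their bounds from feasibility of the window solution.

  Two properties involve more than a single hour. The battery recursion at hour \<open>h < \<delta>\<close> of a
  day is imposed only strictly before the end of the window, and it is available because hour
  \<open>h + 1\<close> of the same day is still in the window; the restriction \<open>h < \<delta>\<close> is what makes this
  work for a day at the very end of the horizon. The switching profile is an absolute
  difference of two binary values, whichever binary value is appended after the last hour.
\<close>

text \<open>
  Retained part and window start at the same hour. A single retained day fits because the window
  is at least one day long; when more than a day is retained, it is the whole window.
\<close>

lemma mh_retained_subset_window:
  assumes "0 < w" and "r + w \<le> D"
  shows "mh_retained \<delta> D w r \<subseteq> mh_window \<delta> D w r"
proof (cases r)
  case 0
  have "\<delta> * 1 \<le> \<delta> * w"
    using assms(1) by (intro mult_le_mono2) simp
  then have "int \<delta> \<le> int (\<delta> * w)"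
    by (simp only: of_nat_le_iff)
  then show ?thesis
    using 0 by (simp add: mh_retained_def mh_window_def)
next
  case (Suc r')
  have "\<delta> * (Suc r' + 1) \<le> \<delta> * (Suc r' + w)"
    using assms(1) by (intro mult_le_mono2) simp
  then have "int (\<delta> * (Suc r' + 1)) \<le> int (\<delta> * (Suc r' + w))"
    by (simp only: of_nat_le_iff)
  then show ?thesis
    using Suc assms(2)
    by (auto simp del: of_nat_mult of_nat_add simp: mh_retained_def mh_window_def)
qed

lemma finite_mh_window: "finite (mh_window \<delta> D w r)"
  by (induction r) (auto simp: mh_window_def)

lemma extracted_hour_in_window:
  assumes "0 < w" and "(r, e) \<in> extracted \<delta> D w" and "h \<in> {1..\<delta>}"
  shows "int (\<delta> * e + h) \<in> mh_window \<delta> D w r"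
proof -
  have "int (\<delta> * e + h) \<in> day \<delta> e"
    using assms(3) by (auto simp: day_def)
  moreover have "r + w \<le> D" "day \<delta> e \<subseteq> mh_retained \<delta> D w r"
    using assms(2) by (simp_all add: extracted_def)
  ultimately show ?thesis
    using mh_retained_subset_window[OF assms(1)] by blast
qed

lemma extracted_feasible:
  assumes "mh_run G \<delta> D w sol" and "(r, e) \<in> extracted \<delta> D w"
  shows "feasible G (mh_window \<delta> D w r) (sol r)"
  using assms by (auto simp: mh_run_def extracted_def optimal_def)

lemma profile_apply: "h \<in> {1..\<delta>} \<Longrightarrow> profile \<delta> f e h = f (int (\<delta> * e + h))"
  by (simp add: profile_def)

lemma profile_nonneg:
  assumes "\<And>h. h \<in> {1..\<delta>} \<Longrightarrow> 0 \<le> f (int (\<delta> * e + h))"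
  shows "profile \<delta> f e \<in> nonneg_vecs \<delta>"
  unfolding profile_def nonneg_vecs_def restrict_PiE_iff using assms by blast

lemma profile_binary:
  assumes "\<And>h. h \<in> {1..\<delta>} \<Longrightarrow> f (int (\<delta> * e + h)) \<in> {0, 1}"
  shows "profile \<delta> f e \<in> binary_vecs \<delta>"
  unfolding profile_def binary_vecs_def restrict_PiE_iff using assms by blast

text \<open>
  The sign of the electricity purchase is constrained month by month; since the months partition
  the window, each hour is covered by the constraint of its own month.
\<close>

lemma feasible_purchase_nonneg:
  assumes "feasible G \<T> S" and "t \<in> \<T>"
  shows "0 \<le> v_u S t"
  using assms by (auto simp: feasible_def power_constr_def months_def month_hours_def)

text \<open>
  The problem imposes the battery recursion at hours before the end of its window. Stating it
  for any two consecutive hours of the window frees its use from locating that end.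
\<close>

lemma feasible_battery_step:
  assumes "feasible G \<T> S" and "finite \<T>" and "t \<in> \<T>" and "t + 1 \<in> \<T>"
  shows "v_b S (t + 1) = (1 - loss_P G) * v_b S t + v_bIO S t"
proof -
  have "t < Max \<T>"
    using Max_ge[OF assms(2,4)] by simp
  then show ?thesis
    using assms(1,3) by (simp add: feasible_def battery_constr_def)
qed

lemma switching_binary:
  assumes "X \<in> binary_vecs \<delta>" and "v \<in> {0, 1}"
  shows "switching \<delta> X v \<in> binary_vecs \<delta>"
  unfolding switching_def binary_vecs_def
proof (rule restrict_PiE_iff[THEN iffD2], rule ballI)
  fix h assume h: "h \<in> {1..\<delta>}"
  have X: "X k \<in> {0, 1}" if "k \<in> {1..\<delta>}" for k
    using PiE_mem[OF assms(1)[unfolded binary_vecs_def] that] .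
  \<comment> \<open>The appended value is read only at \<open>h = \<delta>\<close>; earlier entries compare values of \<open>X\<close>.\<close>
  have "(X(\<delta> + 1 := v)) (h + 1) \<in> {0, 1}"
    using X[of "h + 1"] assms(2) h by (cases "h = \<delta>") auto
  then show "\<bar>(X(\<delta> + 1 := v)) (h + 1) - X h\<bar> \<in> {0, 1}"
    using X[OF h] by (elim insertE emptyE) auto
qed

theorem proposition3p1:
  fixes G :: cogen and \<delta> D w :: nat and sol :: "nat \<Rightarrow> milp_sol"
  assumes "0 < \<delta>" and "0 < w" and "w < D"
    and "mh_run G \<delta> D w sol"
  shows
    "Q_profiles \<delta> D w sol \<subseteq> nonneg_vecs \<delta>
     \<and> U_profiles \<delta> D w sol \<subseteq> nonneg_vecs \<delta>
     \<and> (\<forall>(B, BIO) \<in> B_profiles \<delta> D w sol.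
          B \<in> nonneg_vecs \<delta>
          \<and> (\<forall>h\<in>{1..\<delta> - 1}. B (h + 1) = (1 - loss_P G) * B h + BIO h))
     \<and> (\<forall>(S, Sout) \<in> S_profiles \<delta> D w sol.
          S \<in> nonneg_vecs \<delta> \<and> Sout \<in> nonneg_vecs \<delta>
          \<and> (\<forall>h\<in>{1..\<delta>}. Sout h \<le> S h))
     \<and> (\<forall>j\<in>gen_techs. \<forall>X \<in> X_profiles G \<delta> D w sol j.
          X \<in> binary_vecs \<delta>
          \<and> (\<forall>v\<in>{0, 1}. switching \<delta> X v \<in> binary_vecs \<delta>)
          \<and> (\<forall>P \<in> P_profiles G \<delta> D w sol j X.
               P \<in> nonneg_vecs \<delta>
               \<and> (\<forall>h\<in>{1..\<delta>}. R_min G j * X h \<le> P h \<and> P h \<le> R_max G j * X h)))"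
proof -
  note in_window = extracted_hour_in_window[OF assms(2)]
  note feas = extracted_feasible[OF assms(4)]
  have heat: "0 \<le> v_q (sol r) (int (\<delta> * e + h))" "0 \<le> v_s (sol r) (int (\<delta> * e + h))"
      "0 \<le> v_sout (sol r) (int (\<delta> * e + h))"
      "v_sout (sol r) (int (\<delta> * e + h)) \<le> v_s (sol r) (int (\<delta> * e + h))"
    if "(r, e) \<in> extracted \<delta> D w" "h \<in> {1..\<delta>}" for r e h
    using feas[OF that(1)] in_window[OF that] by (auto simp: feasible_def heat_constr_def)
  have battery: "0 \<le> v_b (sol r) (int (\<delta> * e + h))"
    if "(r, e) \<in> extracted \<delta> D w" "h \<in> {1..\<delta>}" for r e h
    using feas[OF that(1)] in_window[OF that] by (auto simp: feasible_def battery_constr_def)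
  have gen: "v_x (sol r) i j (int (\<delta> * e + h)) \<in> {0, 1}" "0 \<le> v_p (sol r) i j (int (\<delta> * e + h))"
      "R_min G j * v_x (sol r) i j (int (\<delta> * e + h)) \<le> v_p (sol r) i j (int (\<delta> * e + h))"
      "v_p (sol r) i j (int (\<delta> * e + h)) \<le> R_max G j * v_x (sol r) i j (int (\<delta> * e + h))"
    if "(r, e) \<in> extracted \<delta> D w" "h \<in> {1..\<delta>}" "j \<in> gen_techs" "i \<in> unit_set G j"
    for r e h i j
  proof -
    have "gen_constr G (mh_window \<delta> D w r) (sol r)"
      using feas[OF that(1)] by (simp add: feasible_def)
    note this[unfolded gen_constr_def, rule_format, OF that(3) in_window[OF that(1,2)]]
    then show "v_x (sol r) i j (int (\<delta> * e + h)) \<in> {0, 1}"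
        "0 \<le> v_p (sol r) i j (int (\<delta> * e + h))"
        "R_min G j * v_x (sol r) i j (int (\<delta> * e + h)) \<le> v_p (sol r) i j (int (\<delta> * e + h))"
        "v_p (sol r) i j (int (\<delta> * e + h)) \<le> R_max G j * v_x (sol r) i j (int (\<delta> * e + h))"
      using that(4) by blast+
  qed
  have Q: "Q_profiles \<delta> D w sol \<subseteq> nonneg_vecs \<delta>"
    unfolding Q_profiles_def using profile_nonneg heat(1) by blast
  have U: "U_profiles \<delta> D w sol \<subseteq> nonneg_vecs \<delta>"
    unfolding U_profiles_def
    using profile_nonneg feasible_purchase_nonneg[OF feas in_window] by blast
  have B: "B \<in> nonneg_vecs \<delta> \<and> (\<forall>h\<in>{1..\<delta> - 1}. B (h + 1) = (1 - loss_P G) * B h + BIO h)"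
    if B_in: "(B, BIO) \<in> B_profiles \<delta> D w sol" for B BIO
  proof -
    obtain r e where re: "(r, e) \<in> extracted \<delta> D w"
      and B: "B = profile \<delta> (v_b (sol r)) e" and BIO: "BIO = profile \<delta> (v_bIO (sol r)) e"
      using B_in by (auto simp: B_profiles_def)
    have "B \<in> nonneg_vecs \<delta>"
      unfolding B by (rule profile_nonneg) (rule battery[OF re])
    moreover have "B (h + 1) = (1 - loss_P G) * B h + BIO h" if "h \<in> {1..\<delta> - 1}" for h
    proof -
      have h: "h \<in> {1..\<delta>}" "h + 1 \<in> {1..\<delta>}"
        using that by auto
      have succ: "int (\<delta> * e + (h + 1)) = int (\<delta> * e + h) + 1"
        by simp
      show ?thesis
        unfolding B BIO profile_apply[OF h(1)] profile_apply[OF h(2)] succ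
        using feasible_battery_step[OF feas[OF re] finite_mh_window in_window[OF re h(1)]]
          in_window[OF re h(2)] unfolding succ by blast
    qed
    ultimately show ?thesis by blast
  qed
  have S: "S \<in> nonneg_vecs \<delta> \<and> Sout \<in> nonneg_vecs \<delta> \<and> (\<forall>h\<in>{1..\<delta>}. Sout h \<le> S h)"
    if S_in: "(S, Sout) \<in> S_profiles \<delta> D w sol" for S Sout
  proof -
    obtain r e where re: "(r, e) \<in> extracted \<delta> D w"
      and S: "S = profile \<delta> (v_s (sol r)) e" and Sout: "Sout = profile \<delta> (v_sout (sol r)) e"
      using S_in by (auto simp: S_profiles_def)
    have "S \<in> nonneg_vecs \<delta>" "Sout \<in> nonneg_vecs \<delta>"
      unfolding S Sout by (rule profile_nonneg, erule heat(2,3)[OF re])+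
    then show ?thesis
      using heat(4)[OF re] by (simp add: S Sout profile_apply del: of_nat_add of_nat_mult)
  qed
  have X: "X \<in> binary_vecs \<delta>"
    if j: "j \<in> gen_techs" and X_in: "X \<in> X_profiles G \<delta> D w sol j" for j X
  proof -
    obtain r e i where re: "(r, e) \<in> extracted \<delta> D w" and i: "i \<in> unit_set G j"
      and X: "X = profile \<delta> (v_x (sol r) i j) e"
      using X_in by (auto simp: X_profiles_def)
    show ?thesis
      unfolding X by (rule profile_binary) (rule gen(1)[OF re _ j i])
  qed
  have P: "P \<in> nonneg_vecs \<delta> \<and> (\<forall>h\<in>{1..\<delta>}. R_min G j * X h \<le> P h \<and> P h \<le> R_max G j * X h)"
    if j: "j \<in> gen_techs" and P_in: "P \<in> P_profiles G \<delta> D w sol j X" for j X P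
  proof -
    \<comment> \<open>\<open>X\<close> may also arise from other units and days; the bounds compare \<open>P\<close> with the on/off
      values of the unit and day that \<open>P\<close> itself comes from.\<close>
    obtain r e i where re: "(r, e) \<in> extracted \<delta> D w" and i: "i \<in> unit_set G j"
      and P: "P = profile \<delta> (v_p (sol r) i j) e" and X: "X = profile \<delta> (v_x (sol r) i j) e"
      using P_in by (auto simp: P_profiles_def)
    have "P \<in> nonneg_vecs \<delta>"
      unfolding P by (rule profile_nonneg) (rule gen(2)[OF re _ j i])
    then show ?thesis
      using gen(3,4)[OF re _ j i]
      by (simp add: P X profile_apply del: of_nat_add of_nat_mult)
  qed
  show ?thesis
  proof (intro conjI ballI)
    show "case p of (B, BIO) \<Rightarrow> B \<in> nonneg_vecs \<delta>
        \<and> (\<forall>h\<in>{1..\<delta> - 1}. B (h + 1) = (1 - loss_P G) * B h + BIO h)"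
      if "p \<in> B_profiles \<delta> D w sol" for p
      using B[of "fst p" "snd p"] that by (simp add: case_prod_beta)
    show "case p of (S, Sout) \<Rightarrow> S \<in> nonneg_vecs \<delta> \<and> Sout \<in> nonneg_vecs \<delta>
        \<and> (\<forall>h\<in>{1..\<delta>}. Sout h \<le> S h)"
      if "p \<in> S_profiles \<delta> D w sol" for p
      using S[of "fst p" "snd p"] that by (simp add: case_prod_beta)
  qed (use Q U X P switching_binary in \<open>simp_all\<close>)
qed

end
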